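(* Let $X=\mathcal{A}^{\mathbb{Z}^d}$, $d\ge1$, with $\mathcal{A}$ a finite alphabet, let $\xi^t$ be a particle system on $X$ (a Markov chain with translation invariant transition probabilities), let $X_r\subseteq X$ be a dynamically invariant subset, and let $\mathcal{M}_r$ be the set of translation invariant probability measures supported by $X_r$. Assume that the Markov chain $\xi^t$ has an invariant measure $\mu\in\mathcal{M}_r$, and let $\acute\xi^t$ be another version of the same Markov chain. Let $L<\infty$ and assume that there exists a coupling, with laws $\mathbb{P}_{x,y}$, under which $$\mathbb{P}_{x,y}\bigl(\xi^t_{|I}=(\sigma^\ell\acute\xi^t)_{|I}\bigr)\longrightarrow 1\quad\text{as } t\to\infty$$ for any pair of initial configurations $\xi^0=x,\ \acute\xi^0=y\in X_r$, any finite segment $I\subset\mathbb{Z}^d$, and some $\ell\in\mathbb{Z}^d$ with $|\ell|\le L$. Then $P^t_*\nu$ converges weakly to $\mu$ as $t\to\infty$ for any $\nu\in\mathcal{M}_r$.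
   Context: $X=\mathcal{A}^{\mathbb{Z}^d}$ carries the product topology and its Borel sigma-algebra $\mathcal{B}$. For $\ell\in\mathbb{Z}^d$, $|\ell|:=\max_i|\ell_i|$; the spatial shift is $(\sigma^\ell x)_i:=x_{i+\ell}$. A measure on $X$ is translation invariant if it is invariant under all $\sigma^\ell$. For $I\subset\mathbb{Z}^d$, $x_{|I}$ denotes the restriction of the configuration $x$ to $I$. The particle system $\xi^t$ is a Markov chain on $X$ with transition probabilities $P^t(x,A)$ satisfying $P^t(x,A)=P^t(\sigma^\ell x,\sigma^\ell A)$ for all $x\in X$, $A\in\mathcal{B}$, $\ell\in\mathbb{Z}^d$. $P^t_*\mu(A)=\int P^t(x,A)\,d\mu(x)$, and $\mu$ is invariant if $P^t_*\mu=\mu$ for all $t$. A set $Y\subseteq X$ is dynamically invariant if $\xi^0\in Y$ implies $\xi^t\in Y$ almost surely for every $t\ge0$. A coupling is a pairs process $(\xi^t,\acute\xi^t)$ on $X\times X$ whose law $\mathbb{P}_{x,y}$ depends measurably on the initial points $\xi^0=x$, $\acute\xi^0=y$, such that $\mathbb{P}_{x,y}(\xi^t\in A)=P^t(x,A)$ and $\mathbb{P}_{x,y}(\acute\xi^t\in A)=P^t(y,A)$ for all $t\ge0$, $A\in\mathcal{B}$ (not assumed Markovian). *)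

theory Defs
  imports "HOL-Probability.Probability"
begin

class alphabet = finite + discrete_topology

instance alphabet \<subseteq> second_countable_topology
proof
  show "\<exists>B::'a::alphabet set set. countable B \<and> open = generate_topology B"
  proof (intro exI conjI)
    show "countable (UNIV :: 'a::alphabet set set)"
      by (simp add: countable_finite)
    show "open = generate_topology (UNIV :: 'a::alphabet set set)"
      by (auto simp: fun_eq_iff intro: discrete_topology_class.open_discrete generate_topology.Basis)
  qed
qed

text \<open>
  The function type carries the product topology, so \<open>borel\<close> on configurations is the Borel
  sigma-algebra of the product topology.
\<close>

type_synonym ('d, 'a) config = "int ^ 'd \<Rightarrow> 'a"

definition site_norm :: "int ^ 'd::finite \<Rightarrow> int" where
  "site_norm l = Max (range (\<lambda>i. \<bar>l $ i\<bar>))"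

definition shift :: "int ^ 'd::finite \<Rightarrow> ('d, 'a) config \<Rightarrow> ('d, 'a) config" where
  "shift l x = (\<lambda>i. x (i + l))"

definition translation_invariant :: "('d::finite, 'a::alphabet) config measure \<Rightarrow> bool" where
  "translation_invariant \<nu> \<longleftrightarrow> (\<forall>l. distr \<nu> borel (shift l) = \<nu>)"

text \<open>Both discrete and continuous time are allowed.\<close>

definition time_set :: "real set \<Rightarrow> bool" where
  "time_set T \<longleftrightarrow> T = \<nat> \<or> T = {0..}"

text \<open>
  \<open>P t x\<close> is the law of the chain at time \<open>t\<close> started from \<open>x\<close>; only the times in \<open>T\<close> matter.
\<close>

definition markov_transitions :: "real set \<Rightarrow> (real \<Rightarrow> 'x::topological_space \<Rightarrow> 'x measure) \<Rightarrow> bool" where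
  "markov_transitions T P \<longleftrightarrow>
     (\<forall>t\<in>T. P t \<in> borel \<rightarrow>\<^sub>M prob_algebra borel) \<and>
     (\<forall>x. P 0 x = return borel x) \<and>
     (\<forall>s\<in>T. \<forall>t\<in>T. \<forall>x. P (s + t) x = P s x \<bind> P t)"

definition particle_system ::
  "real set \<Rightarrow> (real \<Rightarrow> ('d::finite, 'a::alphabet) config \<Rightarrow> ('d, 'a) config measure) \<Rightarrow> bool" where
  "particle_system T P \<longleftrightarrow>
     markov_transitions T P \<and>
     (\<forall>t\<in>T. \<forall>x. \<forall>A\<in>sets borel. \<forall>l.
        measure (P t x) A = measure (P t (shift l x)) (shift l ` A))"

text \<open>
  The image \<open>A \<mapsto> \<integral> P t x A d\<nu>(x)\<close> of \<open>\<nu>\<close> under the kernel (cf. \<open>emeasure_bind\<close>).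
\<close>

definition push :: "(real \<Rightarrow> 'x \<Rightarrow> 'x measure) \<Rightarrow> real \<Rightarrow> 'x measure \<Rightarrow> 'x measure" where
  "push P t \<nu> = \<nu> \<bind> P t"

definition invariant_measure :: "real set \<Rightarrow> (real \<Rightarrow> 'x \<Rightarrow> 'x measure) \<Rightarrow> 'x measure \<Rightarrow> bool" where
  "invariant_measure T P \<mu> \<longleftrightarrow> (\<forall>t\<in>T. push P t \<mu> = \<mu>)"

definition dynamically_invariant :: "real set \<Rightarrow> (real \<Rightarrow> 'x \<Rightarrow> 'x measure) \<Rightarrow> 'x set \<Rightarrow> bool" where
  "dynamically_invariant T P Y \<longleftrightarrow> (\<forall>x\<in>Y. \<forall>t\<in>T. AE z in P t x. z \<in> Y)"

text \<open>
  \<open>Y\<close> need not be a Borel set; a measure is supported by \<open>Y\<close> if the complement of \<open>Y\<close> is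
  contained in a Borel null set.
\<close>

definition translation_invariant_measures_on ::
  "('d::finite, 'a::alphabet) config set \<Rightarrow> ('d, 'a) config measure set" where
  "translation_invariant_measures_on Y =
     {\<nu>. sets \<nu> = sets borel \<and> prob_space \<nu> \<and> translation_invariant \<nu> \<and> (AE x in \<nu>. x \<in> Y)}"

definition pair_path_space :: "real set \<Rightarrow> (real \<Rightarrow> 'x::topological_space \<times> 'x) measure" where
  "pair_path_space T = Pi\<^sub>M T (\<lambda>_. borel \<Otimes>\<^sub>M borel)"

text \<open>
  \<open>Q (x, y)\<close> is the law of the pair process started from \<open>(x, y)\<close>, as a measure on path space;
  for a path \<open>\<omega>\<close> the two components at time \<open>t\<close> are \<open>fst (\<omega> t)\<close> and \<open>snd (\<omega> t)\<close>.
  The pair process is not assumed to be Markovian.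
\<close>

definition coupling ::
  "real set \<Rightarrow> (real \<Rightarrow> 'x::topological_space \<Rightarrow> 'x measure) \<Rightarrow>
   ('x \<times> 'x \<Rightarrow> (real \<Rightarrow> 'x \<times> 'x) measure) \<Rightarrow> bool" where
  "coupling T P Q \<longleftrightarrow>
     Q \<in> borel \<Otimes>\<^sub>M borel \<rightarrow>\<^sub>M prob_algebra (pair_path_space T) \<and>
     (\<forall>x y. AE \<omega> in Q (x, y). \<omega> 0 = (x, y)) \<and>
     (\<forall>x y. \<forall>t\<in>T. \<forall>A\<in>sets borel.
        \<P>(\<omega> in Q (x, y). fst (\<omega> t) \<in> A) = measure (P t x) A \<and>
        \<P>(\<omega> in Q (x, y). snd (\<omega> t) \<in> A) = measure (P t y) A)"

definition weakly_converges ::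
  "('t \<Rightarrow> 'x::topological_space measure) \<Rightarrow> 'x measure \<Rightarrow> 't filter \<Rightarrow> bool" where
  "weakly_converges \<nu> \<mu> F \<longleftrightarrow>
     (\<forall>f::'x \<Rightarrow> real. continuous_on UNIV f \<and> bounded (range f) \<longrightarrow>
        ((\<lambda>t. \<integral>x. f x \<partial>\<nu> t) \<longlongrightarrow> (\<integral>x. f x \<partial>\<mu>)) F)"

definition time_at_top :: "real set \<Rightarrow> real filter" where
  "time_at_top T = inf at_top (principal T)"

end

theory Submission
  imports Defs
begin

text \<open>
  The coupling makes the two processes agree on a finite window only up to a shift \<open>l\<close>, and this
  shift may depend on the starting points and on the window. Spatial averaging absorbs it. Let
  \<open>f\<close> be continuous and let \<open>g\<close> be the average of \<open>f \<circ> \<sigma>\<^sup>k\<close> over all \<open>k\<close> in a cube of radius \<open>n\<close>.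
  Three facts about \<open>g\<close> carry the proof.

  First, \<open>f\<close> and \<open>g\<close> have the same integral under every translation invariant measure
  (\<open>integral_cube_average\<close>), hence under \<open>\<mu>\<close> and, as the transition probabilities commute with
  shifts, under every \<open>P\<^sup>t\<^sub>*\<nu>\<close> (\<open>translation_invariant_push\<close>). Second, a shift of size at most \<open>L\<close>
  only moves the boundary layer of the cube, so it changes \<open>g\<close> by an amount that tends to \<open>0\<close>
  with \<open>n\<close>, uniformly in the shift (\<open>cube_average_shift\<close>). Third, the configuration space is
  compact, so \<open>f\<close> is determined up to a small error by finitely many sites
  (\<open>continuous_config_almost_local\<close>), and then \<open>g\<close> is determined up to the same error by a larger
  finite window \<open>J\<close>.

  Now choose \<open>n\<close> and then \<open>J\<close>, and apply the coupling on \<open>J\<close>: for any two starting points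
  \<open>x\<close>, \<open>y\<close> in the supporting set, the expectations of \<open>g\<close> at time \<open>t\<close> eventually differ by little
  (\<open>coupling_expectation_bound\<close>). It does not matter that \<open>l\<close> was chosen after \<open>J\<close>, because the
  second fact is uniform in \<open>l\<close>. With \<open>y\<close> held fixed, dominated convergence in \<open>x\<close> shows that the
  integral of \<open>f\<close> under \<open>P\<^sup>t\<^sub>*\<nu>\<close> eventually stays close to the expectation of \<open>g\<close> from \<open>y\<close>. The
  same holds for \<open>P\<^sup>t\<^sub>*\<mu> = \<mu>\<close>, and comparing the two gives the claim.
\<close>

section \<open>Shifts\<close>

lemma shift_apply: "shift l x i = x (i + l)"
  by (simp add: shift_def)

lemma shift_shift: "shift k (shift l x) = shift (k + l) x"
  by (simp add: shift_def algebra_simps)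

lemma shift_0 [simp]: "shift 0 x = x"
  by (simp add: shift_def)

lemma bij_shift: "bij (shift l)"
  by (rule o_bij[where g = "shift (- l)"]) (auto simp: shift_shift o_def)

lemma continuous_on_shift: "continuous_on UNIV (shift l :: ('d::finite, 'a::alphabet) config \<Rightarrow> _)"
  unfolding shift_def by (intro continuous_intros) auto

lemma measurable_shift [measurable]:
  "(shift l :: ('d::finite, 'a::alphabet) config \<Rightarrow> _) \<in> borel \<rightarrow>\<^sub>M borel"
  by (intro borel_measurable_continuous_onI continuous_on_shift)

section \<open>Continuous functions depend on finitely many sites up to a small error\<close>

text \<open>Tychonoff's theorem for the finite alphabet.\<close>

lemma compact_UNIV_config: "compact (UNIV :: ('d::finite, 'a::alphabet) config set)"
proof -
  have "compact_space (euclidean :: 'a topology)"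
    by (simp add: compact_space_def finite_imp_compact)
  then have "compact_space (product_topology (\<lambda>_. euclidean :: 'a topology) (UNIV :: (int^'d) set))"
    by (simp add: compact_space_product_topology)
  then show ?thesis
    by (simp add: euclidean_product_topology compact_space_def)
qed

lemma open_config_contains_cylinder:
  fixes U :: "('d::finite, 'a::alphabet) config set"
  assumes "open U" "x \<in> U"
  obtains I where "finite I" "{y. restrict y I = restrict x I} \<subseteq> U"
proof -
  have "openin (product_topology (\<lambda>_. euclidean) UNIV) U"
    using assms by (simp add: euclidean_product_topology)
  from product_topology_open_contains_basis[OF this \<open>x \<in> U\<close>] obtain V where V:
    "\<forall>i. x i \<in> V i" "finite {i. V i \<noteq> UNIV}" "(\<Pi>\<^sub>E i\<in>UNIV. V i) \<subseteq> U"
    by (auto simp: PiE_iff)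
  have "{y. restrict y {i. V i \<noteq> UNIV} = restrict x {i. V i \<noteq> UNIV}} \<subseteq> (\<Pi>\<^sub>E i\<in>UNIV. V i)"
  proof clarify
    fix y assume eq: "restrict y {i. V i \<noteq> UNIV} = restrict x {i. V i \<noteq> UNIV}"
    have "y i \<in> V i" for i
      using fun_cong[OF eq, of i] V(1) by (cases "V i = UNIV") auto
    then show "y \<in> (\<Pi>\<^sub>E i\<in>UNIV. V i)" by auto
  qed
  from that[OF V(2) subset_trans[OF this V(3)]] show thesis .
qed

text \<open>
  Around each \<open>x\<close> there is a cylinder on which \<open>f\<close> is within \<open>e / 2\<close> of \<open>f x\<close>. By compactness
  finitely many of these cylinders cover the space, and the union of their windows serves as \<open>I\<close>:
  two configurations that agree on \<open>I\<close> lie in a common cylinder.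
\<close>

lemma continuous_config_almost_local:
  fixes f :: "('d::finite, 'a::alphabet) config \<Rightarrow> real"
  assumes f: "continuous_on UNIV f" and "0 < e"
  obtains I where "finite I"
    "\<And>y z. restrict y I = restrict z I \<Longrightarrow> \<bar>f y - f z\<bar> \<le> e"
proof -
  have "\<exists>I. finite I \<and> {y. restrict y I = restrict x I} \<subseteq> f -` ball (f x) (e / 2)" for x
  proof -
    have "open (f -` ball (f x) (e / 2))"
      using f by (intro open_vimage) auto
    moreover have "x \<in> f -` ball (f x) (e / 2)" using \<open>0 < e\<close> by simp
    ultimately show ?thesis by (rule open_config_contains_cylinder) blast
  qed
  then obtain J where J: "\<And>x. finite (J x)"
    and J_subset: "\<And>x. {y. restrict y (J x) = restrict x (J x)} \<subseteq> f -` ball (f x) (e / 2)"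
    by metis
  have J_near: "\<bar>f x - f y\<bar> < e / 2" if "restrict y (J x) = restrict x (J x)" for x y
    using subsetD[OF J_subset, of y x] that by (simp add: dist_real_def)
  let ?C = "\<lambda>x. {y. \<forall>i\<in>J x. y i = x i}"
  have C: "y \<in> ?C x \<longleftrightarrow> restrict y (J x) = restrict x (J x)" for x y
    by (auto simp: restrict_def fun_eq_iff)
  have "open (?C x)" for x :: "('d, 'a) config"
  proof -
    have "?C x = (\<Inter>i\<in>J x. (\<lambda>y. y i) -` {x i})" by auto
    moreover have "open ((\<lambda>y. y i) -` {x i})" for i
      by (intro open_vimage discrete_topology_class.open_discrete) auto
    ultimately show ?thesis using J by (auto intro: open_INT)
  qed
  moreover have "UNIV \<subseteq> (\<Union>x\<in>UNIV. ?C x)" by auto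
  ultimately obtain D where D: "finite D" "UNIV \<subseteq> (\<Union>x\<in>D. ?C x)"
    by (rule compactE_image[OF compact_UNIV_config])
  show thesis
  proof
    show "finite (\<Union>x\<in>D. J x)" using D(1) J by simp
    fix y z :: "('d, 'a) config"
    assume eq: "restrict y (\<Union>x\<in>D. J x) = restrict z (\<Union>x\<in>D. J x)"
    obtain x where x: "x \<in> D" "y \<in> ?C x" using D(2) by blast
    have "y i = z i" if "i \<in> J x" for i
      using fun_cong[OF eq, of i] that x(1) by (auto simp: restrict_def split: if_splits)
    with x have "z \<in> ?C x" by auto
    have "\<bar>f x - f y\<bar> < e / 2" using x(2) unfolding C by (rule J_near)
    moreover have "\<bar>f x - f z\<bar> < e / 2" using \<open>z \<in> ?C x\<close> unfolding C by (rule J_near)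
    ultimately show "\<bar>f y - f z\<bar> \<le> e" by linarith
  qed
qed

section \<open>Averages over cubes\<close>

definition cube :: "nat \<Rightarrow> (int ^ 'd::finite) set" where
  "cube n = {k. \<forall>i. \<bar>k $ i\<bar> \<le> int n}"

definition cube_average :: "nat \<Rightarrow> (('d::finite, 'a) config \<Rightarrow> real) \<Rightarrow> ('d, 'a) config \<Rightarrow> real" where
  "cube_average n f x = (\<Sum>k\<in>cube n. f (shift k x)) / card (cube n :: (int ^ 'd) set)"

lemma mem_cube_iff: "k \<in> cube n \<longleftrightarrow> (\<forall>i. k $ i \<in> {- int n..int n})"
proof -
  have "\<bar>a\<bar> \<le> b \<longleftrightarrow> a \<in> {- b..b}" for a b :: int
    unfolding atLeastAtMost_iff by linarith
  then show ?thesis by (simp only: cube_def mem_Collect_eq)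
qed

lemma cube_eq_image: "cube n = vec_lambda ` (UNIV \<rightarrow>\<^sub>E {- int n..int n})"
proof (intro equalityI subsetI)
  fix k :: "int ^ 'a" assume "k \<in> cube n"
  then have "k = vec_lambda (vec_nth k)" "vec_nth k \<in> UNIV \<rightarrow>\<^sub>E {- int n..int n}"
    by (simp_all add: mem_cube_iff PiE_iff)
  then show "k \<in> vec_lambda ` (UNIV \<rightarrow>\<^sub>E {- int n..int n})" by (rule image_eqI)
next
  fix k :: "int ^ 'a" assume "k \<in> vec_lambda ` (UNIV \<rightarrow>\<^sub>E {- int n..int n})"
  then obtain h where "k = vec_lambda h" "h \<in> UNIV \<rightarrow>\<^sub>E {- int n..int n}" by (rule imageE)
  then show "k \<in> cube n" by (simp add: mem_cube_iff PiE_iff)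
qed

lemma finite_cube [simp]: "finite (cube n)"
  unfolding cube_eq_image by (intro finite_imageI finite_PiE) auto

lemma card_cube: "card (cube n :: (int ^ 'd::finite) set) = (2 * n + 1) ^ CARD('d)"
proof -
  have "card (cube n :: (int ^ 'd) set) = card ((UNIV :: 'd set) \<rightarrow>\<^sub>E {- int n..int n})"
    unfolding cube_eq_image by (intro card_image inj_onI) (simp add: vec_lambda_inject)
  also have "\<dots> = (2 * n + 1) ^ CARD('d)"
    by (simp add: card_PiE nat_add_distrib nat_mult_distrib)
  finally show ?thesis .
qed

lemma cube_mono: "m \<le> n \<Longrightarrow> cube m \<subseteq> cube n"
proof
  fix k :: "int ^ 'a" assume "m \<le> n" "k \<in> cube m"
  then have "\<bar>k $ i\<bar> \<le> int m" "int m \<le> int n" for i by (simp_all add: cube_def)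
  then show "k \<in> cube n" unfolding cube_def by (blast intro: order_trans)
qed

lemma cube_translate_subset: "l \<in> cube m \<Longrightarrow> (\<lambda>k. k + l) ` cube n \<subseteq> cube (n + m)"
proof (intro image_subsetI)
  fix k :: "int ^ 'a" assume "l \<in> cube m" "k \<in> cube n"
  then have "\<bar>k $ i\<bar> + \<bar>l $ i\<bar> \<le> int n + int m" for i
    unfolding cube_def mem_Collect_eq by (intro add_mono) (erule spec)+
  then show "k + l \<in> cube (n + m)"
    unfolding cube_def by (auto intro: order_trans[OF abs_triangle_ineq])
qed

lemma site_norm_le_imp_cube:
  assumes "real_of_int (site_norm l) \<le> L"
  shows "l \<in> cube (nat \<lfloor>L\<rfloor>)"
proof -
  have "\<bar>l $ i\<bar> \<le> site_norm l" for i
    unfolding site_norm_def by (intro Max_ge) auto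
  moreover have "site_norm l \<le> \<lfloor>L\<rfloor>" using assms by (simp add: le_floor_iff)
  ultimately have "\<bar>l $ i\<bar> \<le> int (nat \<lfloor>L\<rfloor>)" for i
    by (rule order_trans[OF order_trans]) simp
  then show ?thesis by (simp add: cube_def)
qed

text \<open>
  Instead of the symmetric difference of \<open>cube n\<close> and its translate by \<open>l\<close>, both are compared with
  \<open>cube (n + m)\<close>. Each is contained in it, and they have the same size, so either sum differs from
  the sum over \<open>cube (n + m)\<close> by at most \<open>C\<close> per remaining site. The bound does not involve \<open>l\<close>.
\<close>

lemma cube_average_shift:
  fixes f :: "('d::finite, 'a) config \<Rightarrow> real"
  assumes f: "\<And>x. \<bar>f x\<bar> \<le> C" and l: "l \<in> cube m"
  shows "\<bar>cube_average n f (shift l x) - cube_average n f x\<bar>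
           \<le> 2 * C * (((2 * real n + 2 * real m + 1) / (2 * real n + 1)) ^ CARD('d) - 1)"
proof -
  let ?c = "\<lambda>n. card (cube n :: (int ^ 'd) set)"
  let ?g = "\<lambda>k. f (shift k x)"
  have near: "\<bar>(\<Sum>k\<in>cube (n + m). ?g k) - (\<Sum>k\<in>S. ?g k)\<bar> \<le> C * (?c (n + m) - ?c n)"
    if S: "S \<subseteq> cube (n + m)" "card S = ?c n" for S
  proof -
    have "finite S" by (rule finite_subset[OF S(1)]) simp
    have "(\<Sum>k\<in>cube (n + m). ?g k) - (\<Sum>k\<in>S. ?g k) = (\<Sum>k\<in>cube (n + m) - S. ?g k)"
      using S by (simp add: sum_diff)
    also have "\<bar>\<dots>\<bar> \<le> (\<Sum>k\<in>cube (n + m) - S. C)"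
      by (intro order_trans[OF sum_abs] sum_mono f)
    also have "\<dots> = C * (?c (n + m) - ?c n)"
      using S \<open>finite S\<close> by (simp add: card_Diff_subset)
    finally show ?thesis .
  qed
  have inj: "inj_on (\<lambda>k. k + l) (cube n)" by (intro inj_onI) simp
  have "(\<Sum>k\<in>cube n. f (shift k (shift l x))) = (\<Sum>k\<in>(\<lambda>k. k + l) ` cube n. ?g k)"
    by (simp add: sum.reindex[OF inj] shift_shift)
  then have "\<bar>(\<Sum>k\<in>cube n. f (shift k (shift l x))) - (\<Sum>k\<in>cube n. ?g k)\<bar>
      \<le> 2 * (C * (?c (n + m) - ?c n))"
    using near[OF cube_translate_subset[OF l] card_image[OF inj]]
      near[OF cube_mono[of n "n + m"] refl] by simp
  then have "\<bar>cube_average n f (shift l x) - cube_average n f x\<bar>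
      \<le> 2 * (C * (?c (n + m) - ?c n)) / ?c n"
    by (simp add: cube_average_def divide_right_mono flip: diff_divide_distrib)
  also have "\<dots> = 2 * C * (real (?c (n + m)) / real (?c n) - 1)"
    using card_mono[OF finite_cube cube_mono[of n "n + m", where 'a = 'd]]
    by (simp add: card_cube of_nat_diff field_simps)
  also have "real (?c (n + m)) / real (?c n)
      = ((2 * real n + 2 * real m + 1) / (2 * real n + 1)) ^ CARD('d)"
    by (simp add: card_cube power_divide algebra_simps)
  finally show ?thesis .
qed

lemma cube_ratio_tendsto:
  "(\<lambda>n. ((2 * real n + 2 * real m + 1) / (2 * real n + 1)) ^ p - 1) \<longlonglongrightarrow> 0"
proof -
  have "(\<lambda>n. 1 / (2 * real n + 1)) \<longlonglongrightarrow> 0"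
    by (rule Lim_null_comparison[OF _ LIMSEQ_inverse_real_of_nat])
      (auto intro!: eventuallyI simp: field_simps)
  then have "(\<lambda>n. (1 + 2 * real m * (1 / (2 * real n + 1))) ^ p - 1)
      \<longlonglongrightarrow> (1 + 2 * real m * 0) ^ p - 1"
    by (intro tendsto_intros)
  moreover have "1 + 2 * real m * (1 / (2 * real n + 1))
      = (2 * real n + 2 * real m + 1) / (2 * real n + 1)" for n
    by (simp add: field_simps)
  ultimately show ?thesis by simp
qed

lemma cube_average_abs_le:
  fixes f :: "('d::finite, 'a) config \<Rightarrow> real"
  assumes "\<And>x. \<bar>f x\<bar> \<le> C"
  shows "\<bar>cube_average n f x\<bar> \<le> C"
proof -
  have "\<bar>\<Sum>k\<in>cube n. f (shift k x)\<bar> \<le> (\<Sum>k\<in>(cube n :: (int ^ 'd) set). C)"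
    by (intro order_trans[OF sum_abs] sum_mono assms)
  then show ?thesis
    by (simp add: cube_average_def card_cube divide_simps mult.commute)
qed

lemma cube_average_local:
  fixes f :: "('d::finite, 'a) config \<Rightarrow> real"
  assumes f: "\<And>y z. restrict y I = restrict z I \<Longrightarrow> \<bar>f y - f z\<bar> \<le> e"
    and eq: "restrict y (\<Union>k\<in>cube n. (\<lambda>i. i + k) ` I) = restrict z (\<Union>k\<in>cube n. (\<lambda>i. i + k) ` I)"
  shows "\<bar>cube_average n f y - cube_average n f z\<bar> \<le> e"
proof -
  have "restrict (shift k y) I = restrict (shift k z) I" if "k \<in> cube n" for k
  proof (rule restrict_ext)
    fix i assume "i \<in> I"
    then have "i + k \<in> (\<Union>k\<in>cube n. (\<lambda>i. i + k) ` I)" using that by blast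
    then show "shift k y i = shift k z i"
      using fun_cong[OF eq, of "i + k"] by (simp add: shift_apply)
  qed
  then have "\<bar>(\<Sum>k\<in>cube n. f (shift k y)) - (\<Sum>k\<in>cube n. f (shift k z))\<bar>
      \<le> (\<Sum>k\<in>(cube n :: (int ^ 'd) set). e)"
    unfolding sum_subtractf[symmetric] by (intro order_trans[OF sum_abs] sum_mono f)
  then show ?thesis
    unfolding cube_average_def diff_divide_distrib[symmetric]
    by (simp add: card_cube divide_simps mult.commute)
qed

lemma measurable_cube_average [measurable]:
  fixes f :: "('d::finite, 'a::alphabet) config \<Rightarrow> real"
  assumes [measurable]: "f \<in> borel_measurable borel"
  shows "cube_average n f \<in> borel_measurable borel"
  unfolding cube_average_def[abs_def] by measurable

lemma integral_cube_average:
  fixes f :: "('d::finite, 'a::alphabet) config \<Rightarrow> real"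
  assumes [measurable]: "f \<in> borel_measurable borel" and f: "\<And>x. \<bar>f x\<bar> \<le> C"
    and sets [simp, measurable_cong]: "sets \<nu> = sets borel" and "prob_space \<nu>"
    and inv: "translation_invariant \<nu>"
  shows "(\<integral>x. cube_average n f x \<partial>\<nu>) = (\<integral>x. f x \<partial>\<nu>)"
proof -
  interpret prob_space \<nu> by fact
  have "(\<integral>x. f (shift k x) \<partial>\<nu>) = (\<integral>x. f x \<partial>\<nu>)" for k
    using integral_distr[of "shift k" \<nu> borel f] inv by (simp add: translation_invariant_def)
  moreover have "integrable \<nu> (\<lambda>x. f (shift k x))" for k
    by (rule integrable_const_bound[where B = C]) (auto simp: f)
  ultimately show ?thesis
    unfolding cube_average_def by (simp add: card_cube)
qed

section \<open>Translation covariant kernels\<close>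

lemma
  assumes "particle_system T P" "t \<in> T"
  shows measurable_transition: "P t \<in> borel \<rightarrow>\<^sub>M prob_algebra borel"
    and prob_space_transition: "prob_space (P t x)"
    and sets_transition: "sets (P t x) = sets borel"
proof -
  show *: "P t \<in> borel \<rightarrow>\<^sub>M prob_algebra borel"
    using assms by (simp add: particle_system_def markov_transitions_def)
  show "prob_space (P t x)" "sets (P t x) = sets borel"
    using measurable_space[OF *, of x] by (auto simp: space_prob_algebra)
qed

text \<open>
  The covariance of the transition probabilities, which is stated through images \<open>\<sigma>\<^sup>l A\<close>, in the
  form of an equality of image measures.
\<close>

lemma distr_transition_shift:
  assumes P: "particle_system T P" and t: "t \<in> T"
  shows "distr (P t x) borel (shift l) = P t (shift l x)"
proof -
  note [simp, measurable_cong] = sets_transition[OF P t]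
  interpret A: prob_space "P t x" using P t by (rule prob_space_transition)
  interpret B: prob_space "P t (shift l x)" using P t by (rule prob_space_transition)
  show ?thesis
  proof (rule measure_eqI)
    fix A assume "A \<in> sets (distr (P t x) borel (shift l))"
    then have A [measurable]: "A \<in> sets borel" by simp
    have sp: "space (P t x) = UNIV" by (metis sets_transition[OF P t] sets_eq_imp_space_eq space_borel)
    have *: "shift l -` A \<in> sets borel"
      using measurable_sets[OF measurable_shift A] by simp
    have "shift l ` (shift l -` A) = A"
      by (simp add: surj_image_vimage_eq bij_is_surj[OF bij_shift])
    then have "measure (P t x) (shift l -` A) = measure (P t (shift l x)) A"
      using P t * unfolding particle_system_def by metis
    then show "emeasure (distr (P t x) borel (shift l)) A = emeasure (P t (shift l x)) A"
      by (simp add: emeasure_distr sp A.emeasure_eq_measure B.emeasure_eq_measure)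
  qed simp
qed

lemma
  assumes P: "particle_system T P" and t: "t \<in> T"
    and \<nu>: "sets \<nu> = sets borel" "prob_space \<nu>"
  shows sets_push: "sets (push P t \<nu>) = sets borel"
    and prob_space_push: "prob_space (push P t \<nu>)"
proof -
  have "\<nu> \<in> space (prob_algebra borel)" using \<nu> by (simp add: space_prob_algebra)
  note * = prob_space_bind'[OF this measurable_transition[OF P t]]
    sets_bind'[OF this measurable_transition[OF P t]]
  from * show "sets (push P t \<nu>) = sets borel" "prob_space (push P t \<nu>)"
    unfolding push_def by simp_all
qed

lemma integral_push:
  fixes f :: "('d::finite, 'a::alphabet) config \<Rightarrow> real"
  assumes P: "particle_system T P" and t: "t \<in> T"
    and \<nu>: "sets \<nu> = sets borel" "prob_space \<nu>"
    and f: "f \<in> borel_measurable borel" "\<And>x. \<bar>f x\<bar> \<le> C"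
  shows "(\<integral>x. f x \<partial>push P t \<nu>) = (\<integral>x. (\<integral>z. f z \<partial>P t x) \<partial>\<nu>)"
  unfolding push_def
proof (rule integral_bind[where K = borel and B = C and B' = 1])
  show "P t \<in> \<nu> \<rightarrow>\<^sub>M subprob_algebra borel"
    using measurable_prob_algebraD[OF measurable_transition[OF P t]] \<nu>(1)
    by (simp cong: measurable_cong_sets)
  show "finite_measure \<nu>" using \<nu>(2) by (simp add: prob_space.finite_measure)
  show "AE x in \<nu>. emeasure (P t x) (space (P t x)) \<le> ennreal 1"
    using prob_space_transition[OF P t] by (simp add: prob_space.emeasure_space_1)
qed (use f in auto)

lemma translation_invariant_push:
  assumes P: "particle_system T P" and t: "t \<in> T"
    and \<nu>: "sets \<nu> = sets borel" "prob_space \<nu>" "translation_invariant \<nu>"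
  shows "translation_invariant (push P t \<nu>)"
  unfolding translation_invariant_def
proof
  fix l
  have m: "P t \<in> borel \<rightarrow>\<^sub>M subprob_algebra borel"
    using measurable_transition[OF P t] by (rule measurable_prob_algebraD)
  have m': "P t \<in> \<nu> \<rightarrow>\<^sub>M subprob_algebra borel" using m \<nu>(1) by (simp cong: measurable_cong_sets)
  have ne: "space \<nu> \<noteq> {}" using \<nu>(2) by (simp add: prob_space.not_empty)
  have s: "shift l \<in> \<nu> \<rightarrow>\<^sub>M borel" using \<nu>(1) by (simp cong: measurable_cong_sets)
  have "distr (\<nu> \<bind> P t) borel (shift l) = \<nu> \<bind> (\<lambda>x. distr (P t x) borel (shift l))"
    by (rule distr_bind[OF m' ne measurable_shift])
  also have "\<dots> = \<nu> \<bind> (\<lambda>x. P t (shift l x))"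
    by (simp add: distr_transition_shift[OF P t])
  also have "\<dots> = distr \<nu> borel (shift l) \<bind> P t"
    by (rule bind_distr[OF s m ne, symmetric])
  also have "\<dots> = \<nu> \<bind> P t" using \<nu>(3) by (simp add: translation_invariant_def)
  finally show "distr (push P t \<nu>) borel (shift l) = push P t \<nu>" unfolding push_def .
qed

section \<open>Consequences of the coupling\<close>

lemma
  assumes "coupling T P Q"
  shows prob_space_coupling: "prob_space (Q (x, y))"
    and sets_coupling: "sets (Q (x, y)) = sets (pair_path_space T)"
proof -
  have "Q \<in> borel \<Otimes>\<^sub>M borel \<rightarrow>\<^sub>M prob_algebra (pair_path_space T)"
    using assms by (simp add: coupling_def)
  from measurable_space[OF this, of "(x, y)"]
  show "prob_space (Q (x, y))" "sets (Q (x, y)) = sets (pair_path_space T)"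
    by (auto simp: space_prob_algebra space_pair_measure)
qed

lemma
  assumes Q: "coupling T P Q" and t: "t \<in> T"
  shows measurable_fst_coupling: "(\<lambda>\<omega>. fst (\<omega> t)) \<in> Q (x, y) \<rightarrow>\<^sub>M borel"
    and measurable_snd_coupling: "(\<lambda>\<omega>. snd (\<omega> t)) \<in> Q (x, y) \<rightarrow>\<^sub>M borel"
proof -
  have "(\<lambda>\<omega>. \<omega> t) \<in> Q (x, y) \<rightarrow>\<^sub>M borel \<Otimes>\<^sub>M borel"
    unfolding measurable_cong_sets[OF sets_coupling[OF Q] refl] pair_path_space_def
    by (rule measurable_component_singleton[OF t])
  then show "(\<lambda>\<omega>. fst (\<omega> t)) \<in> Q (x, y) \<rightarrow>\<^sub>M borel" "(\<lambda>\<omega>. snd (\<omega> t)) \<in> Q (x, y) \<rightarrow>\<^sub>M borel"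
    by measurable
qed

lemma
  assumes P: "particle_system T P" and Q: "coupling T P Q" and t: "t \<in> T"
  shows distr_fst_coupling: "distr (Q (x, y)) borel (\<lambda>\<omega>. fst (\<omega> t)) = P t x"
    and distr_snd_coupling: "distr (Q (x, y)) borel (\<lambda>\<omega>. snd (\<omega> t)) = P t y"
proof -
  interpret Q: prob_space "Q (x, y)" using Q by (rule prob_space_coupling)
  have eqI: "distr (Q (x, y)) borel g = P t z"
    if [measurable]: "g \<in> Q (x, y) \<rightarrow>\<^sub>M borel"
      and eq: "\<And>A. A \<in> sets borel \<Longrightarrow> \<P>(\<omega> in Q (x, y). g \<omega> \<in> A) = measure (P t z) A" for g z
  proof (rule measure_eqI)
    interpret B: prob_space "P t z" using P t by (rule prob_space_transition)
    fix A assume "A \<in> sets (distr (Q (x, y)) borel g)"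
    then have "A \<in> sets borel" by simp
    moreover have "g -` A \<inter> space (Q (x, y)) = {\<omega> \<in> space (Q (x, y)). g \<omega> \<in> A}" by auto
    ultimately show "emeasure (distr (Q (x, y)) borel g) A = emeasure (P t z) A"
      by (simp add: emeasure_distr Q.emeasure_eq_measure B.emeasure_eq_measure eq)
  qed (simp add: sets_transition[OF P t])
  show "distr (Q (x, y)) borel (\<lambda>\<omega>. fst (\<omega> t)) = P t x"
    using Q t by (intro eqI measurable_fst_coupling[OF Q t]) (auto simp: coupling_def)
  show "distr (Q (x, y)) borel (\<lambda>\<omega>. snd (\<omega> t)) = P t y"
    using Q t by (intro eqI measurable_snd_coupling[OF Q t]) (auto simp: coupling_def)
qed

text \<open>
  As the alphabet is finite, agreement at a site is a finite union of events that prescribe the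
  common symbol.
\<close>

lemma measurable_coupling_agree:
  assumes Q: "coupling T (P :: real \<Rightarrow> ('d::finite, 'a::alphabet) config \<Rightarrow> _) Q" and t: "t \<in> T"
    and "finite I"
  shows "{\<omega> \<in> space (Q (x, y)). restrict (fst (\<omega> t)) I = restrict (shift l (snd (\<omega> t))) I}
           \<in> sets (Q (x, y))"
proof -
  have site: "{\<omega> \<in> space (Q (x, y)). u \<omega> i = c} \<in> sets (Q (x, y))"
    if u: "u \<in> Q (x, y) \<rightarrow>\<^sub>M borel" for u :: "_ \<Rightarrow> ('d, 'a) config" and i c
  proof -
    have "(\<lambda>x. x i) \<in> borel_measurable (borel :: ('d, 'a) config measure)"
      by (intro borel_measurable_continuous_onI) auto
    from measurable_compose[OF u this] have "(\<lambda>\<omega>. u \<omega> i) -` {c} \<inter> space (Q (x, y)) \<in> sets (Q (x, y))"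
      by (rule measurable_sets) (simp add: borel_open discrete_topology_class.open_discrete)
    moreover have "(\<lambda>\<omega>. u \<omega> i) -` {c} \<inter> space (Q (x, y)) = {\<omega> \<in> space (Q (x, y)). u \<omega> i = c}"
      by auto
    ultimately show ?thesis by simp
  qed
  have [measurable]: "Measurable.pred (Q (x, y)) (\<lambda>\<omega>. fst (\<omega> t) i = c)"
    "Measurable.pred (Q (x, y)) (\<lambda>\<omega>. snd (\<omega> t) i = c)" for i c
    using site[OF measurable_fst_coupling[OF Q t]] site[OF measurable_snd_coupling[OF Q t]]
    by (simp_all add: pred_def)
  have "(restrict (fst (\<omega> t)) I = restrict (shift l (snd (\<omega> t))) I) \<longleftrightarrow>
      (\<forall>i\<in>I. \<exists>c\<in>UNIV. fst (\<omega> t) i = c \<and> snd (\<omega> t) (i + l) = c)"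
    for \<omega> :: "real \<Rightarrow> ('d, 'a) config \<times> ('d, 'a) config"
    by (auto simp: restrict_def fun_eq_iff shift_apply)
  moreover have "{\<omega> \<in> space (Q (x, y)).
      \<forall>i\<in>I. \<exists>c\<in>UNIV. fst (\<omega> t) i = c \<and> snd (\<omega> t) (i + l) = c} \<in> sets (Q (x, y))"
    using \<open>finite I\<close> by measurable
  ultimately show ?thesis by (simp only:)
qed

text \<open>
  On the event of agreement, pass from \<open>g\<close> of the first component to \<open>g\<close> of the shifted second
  component at cost \<open>e\<close>, and undo the shift at cost \<open>\<delta>\<close>. Off this event use the trivial
  bound \<open>2 * C\<close>.
\<close>

lemma coupling_expectation_bound:
  fixes f :: "('d::finite, 'a::alphabet) config \<Rightarrow> real"
  assumes P: "particle_system T P" and Q: "coupling T P Q" and t: "t \<in> T"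
    and g [measurable]: "g \<in> borel_measurable borel" and gC: "\<And>x. \<bar>g x\<bar> \<le> C"
    and "finite J"
    and g_local: "\<And>y z. restrict y J = restrict z J \<Longrightarrow> \<bar>g y - g z\<bar> \<le> e"
    and g_shift: "\<And>z. \<bar>g (shift l z) - g z\<bar> \<le> \<delta>"
  shows "\<bar>(\<integral>z. g z \<partial>P t x) - (\<integral>z. g z \<partial>P t y)\<bar>
    \<le> e + \<delta> + 2 * C * (1 - \<P>(\<omega> in Q (x, y).
          restrict (fst (\<omega> t)) J = restrict (shift l (snd (\<omega> t))) J))"
proof -
  interpret Q: prob_space "Q (x, y)" using Q by (rule prob_space_coupling)
  note [measurable] = measurable_fst_coupling[OF Q t] measurable_snd_coupling[OF Q t]
  define E where "E = {\<omega> \<in> space (Q (x, y)).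
    restrict (fst (\<omega> t)) J = restrict (shift l (snd (\<omega> t))) J}"
  have E [measurable]: "E \<in> sets (Q (x, y))"
    unfolding E_def by (rule measurable_coupling_agree[OF Q t \<open>finite J\<close>])
  have "0 \<le> e" using g_local[of undefined undefined] by simp
  have int: "integrable (Q (x, y)) (\<lambda>\<omega>. g (fst (\<omega> t)))" "integrable (Q (x, y)) (\<lambda>\<omega>. g (snd (\<omega> t)))"
    by (rule Q.integrable_const_bound[where B = C]; simp add: gC)+
  have pointwise: "\<bar>g (fst (\<omega> t)) - g (snd (\<omega> t))\<bar> \<le> e + \<delta> + 2 * C * (1 - indicator E \<omega>)"
    if "\<omega> \<in> space (Q (x, y))" for \<omega>
  proof (cases "\<omega> \<in> E")
    case True
    then show ?thesis
      using g_local[of "fst (\<omega> t)" "shift l (snd (\<omega> t))"] g_shift[of "snd (\<omega> t)"]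
      by (simp add: E_def)
  next
    case False
    then show ?thesis
      using gC[of "fst (\<omega> t)"] gC[of "snd (\<omega> t)"] \<open>0 \<le> e\<close> g_shift[of "fst (\<omega> t)"]
      by simp
  qed
  have "(\<integral>z. g z \<partial>P t x) - (\<integral>z. g z \<partial>P t y)
      = (\<integral>\<omega>. g (fst (\<omega> t)) \<partial>Q (x, y)) - (\<integral>\<omega>. g (snd (\<omega> t)) \<partial>Q (x, y))"
    by (subst distr_fst_coupling[OF P Q t, of x y, symmetric],
        subst distr_snd_coupling[OF P Q t, of x y, symmetric]) (simp add: integral_distr)
  also have "\<dots> = (\<integral>\<omega>. g (fst (\<omega> t)) - g (snd (\<omega> t)) \<partial>Q (x, y))"
    using int by simp
  also have "\<bar>\<dots>\<bar> \<le> (\<integral>\<omega>. \<bar>g (fst (\<omega> t)) - g (snd (\<omega> t))\<bar> \<partial>Q (x, y))"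
    by (rule integral_abs_bound)
  also have "\<dots> \<le> (\<integral>\<omega>. e + \<delta> + 2 * C * (1 - indicator E \<omega>) \<partial>Q (x, y))"
    using int by (intro integral_mono pointwise) (auto simp: Q.emeasure_eq_measure)
  also have "\<dots> = e + \<delta> + 2 * C * (1 - measure (Q (x, y)) E)"
    by (simp add: Q.prob_space Q.emeasure_eq_measure)
  finally show ?thesis unfolding E_def .
qed

section \<open>Passing to the limit under the integral\<close>

lemma eventually_time_at_top:
  "eventually R (time_at_top T) \<longleftrightarrow> eventually (\<lambda>t. t \<in> T \<longrightarrow> R t) at_top"
  unfolding time_at_top_def by (rule eventually_inf_principal)

text \<open>
  Pointwise the functions need not converge; they are only known to be small eventually. Dominated
  convergence therefore applies to the excess of \<open>\<bar>g t x\<bar>\<close> over \<open>e\<close>, which tends to \<open>0\<close>.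
\<close>

lemma (in prob_space) eventually_abs_integral_less:
  fixes g :: "real \<Rightarrow> 'a \<Rightarrow> real"
  assumes meas: "\<And>t. t \<in> T \<Longrightarrow> g t \<in> borel_measurable M"
    and bound: "\<And>t x. t \<in> T \<Longrightarrow> \<bar>g t x\<bar> \<le> C"
    and small: "AE x in M. eventually (\<lambda>t. \<bar>g t x\<bar> < e) (time_at_top T)"
    and "e < e'"
  shows "eventually (\<lambda>t. \<bar>\<integral>x. g t x \<partial>M\<bar> < e') (time_at_top T)"
proof -
  \<comment> \<open>The value \<open>0\<close> outside \<open>T\<close> turns the limit along \<open>T\<close> into a limit along all real times.\<close>
  define h where "h t x = (if t \<in> T then max (\<bar>g t x\<bar> - e) 0 else 0)" for t x
  have [measurable]: "h t \<in> borel_measurable M" for t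
    using meas[of t] unfolding h_def by (cases "t \<in> T") auto
  have h_bound: "norm (h t x) \<le> \<bar>C\<bar> + \<bar>e\<bar>" for t x
    using bound[of t x] by (auto simp: h_def)
  have "((\<lambda>t. \<integral>x. h t x \<partial>M) \<longlongrightarrow> (\<integral>x. 0 \<partial>M)) at_top"
  proof (rule integral_dominated_convergence_at_top[where w = "\<lambda>_. \<bar>C\<bar> + \<bar>e\<bar>"])
    show "AE x in M. ((\<lambda>t. h t x) \<longlongrightarrow> 0) at_top"
      using small
    proof eventually_elim
      case (elim x)
      then show ?case
        unfolding eventually_time_at_top
        by (intro tendsto_eventually) (auto elim!: eventually_mono simp: h_def)
    qed
  qed (use h_bound in auto)
  then have "eventually (\<lambda>t. (\<integral>x. h t x \<partial>M) < e' - e) at_top"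
    using \<open>e < e'\<close> by (intro order_tendstoD) auto
  then show ?thesis
    unfolding eventually_time_at_top
  proof (eventually_elim, intro impI)
    fix t assume less: "(\<integral>x. h t x \<partial>M) < e' - e" and t: "t \<in> T"
    have int: "integrable M (g t)" "integrable M (h t)"
      by (rule integrable_const_bound[where B = C], use meas[OF t] bound[OF t] in auto)
        (rule integrable_const_bound[where B = "\<bar>C\<bar> + \<bar>e\<bar>"], use h_bound in auto)
    have "\<bar>\<integral>x. g t x \<partial>M\<bar> \<le> (\<integral>x. \<bar>g t x\<bar> \<partial>M)" by (rule integral_abs_bound)
    also have "\<dots> \<le> (\<integral>x. h t x + e \<partial>M)"
      using int t by (intro integral_mono) (auto simp: h_def)
    also have "\<dots> = (\<integral>x. h t x \<partial>M) + e" using int by (simp add: prob_space)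
    finally show "\<bar>\<integral>x. g t x \<partial>M\<bar> < e'" using less by simp
  qed
qed

section \<open>Convergence\<close>

text \<open>
  The radius \<open>n\<close> is the same for all \<open>\<nu>\<close> and \<open>y\<close>, so the expectation from a single point \<open>y\<close> can
  serve as a common reference value for \<open>\<nu>\<close> and for the invariant measure.
\<close>

lemma push_eventually_close_to_point:
  fixes P :: "real \<Rightarrow> ('d::finite, 'a::alphabet) config \<Rightarrow> ('d, 'a) config measure"
  assumes P: "particle_system T P" and Q: "coupling T P Q"
    and agree: "\<And>x y I. x \<in> Y \<Longrightarrow> y \<in> Y \<Longrightarrow> finite I \<Longrightarrow>
           \<exists>l. real_of_int (site_norm l) \<le> L \<and>
             ((\<lambda>t. \<P>(\<omega> in Q (x, y).
                 restrict (fst (\<omega> t)) I = restrict (shift l (snd (\<omega> t))) I)) \<longlongrightarrow> 1)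
               (time_at_top T)"
    and f: "continuous_on UNIV f" "\<And>x. \<bar>f x\<bar> \<le> C" and "0 < e"
  shows "\<exists>n. \<forall>\<nu>\<in>translation_invariant_measures_on Y. \<forall>y\<in>Y.
      eventually (\<lambda>t. \<bar>(\<integral>x. f x \<partial>push P t \<nu>) - (\<integral>z. cube_average n f z \<partial>P t y)\<bar> < e)
        (time_at_top T)"
proof -
  have [measurable]: "f \<in> borel_measurable borel"
    using f(1) by (rule borel_measurable_continuous_onI)
  have "0 \<le> C" using f(2)[of undefined] by simp
  define m where "m = nat \<lfloor>L\<rfloor>"
  \<comment> \<open>The most that a shift allowed by \<open>L\<close> can change the average over \<open>cube n\<close>.\<close>
  define r where "r n = 2 * C * (((2 * real n + 2 * real m + 1) / (2 * real n + 1)) ^ CARD('d) - 1)"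
    for n
  have "r \<longlonglongrightarrow> 2 * C * 0"
    unfolding r_def by (intro tendsto_intros cube_ratio_tendsto)
  then have "eventually (\<lambda>n. r n < e / 8) sequentially"
    using \<open>0 < e\<close> by (intro order_tendstoD) auto
  then obtain n where n: "r n < e / 8"
    using eventually_happens' trivial_limit_sequentially by blast
  obtain I where I: "finite I" "\<And>y z. restrict y I = restrict z I \<Longrightarrow> \<bar>f y - f z\<bar> \<le> e / 8"
    using continuous_config_almost_local[OF f(1), of "e / 8"] \<open>0 < e\<close> by auto
  \<comment> \<open>The window on which the averaged function depends up to \<open>e / 8\<close>.\<close>
  define J where "J = (\<Union>k\<in>cube n. (\<lambda>i. i + k) ` I)"
  have "finite J" using I(1) by (simp add: J_def)
  let ?g = "cube_average n f"
  have g_bound: "\<bar>?g x\<bar> \<le> C" for x by (intro cube_average_abs_le f)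
  have pointwise: "eventually (\<lambda>t. \<bar>(\<integral>z. ?g z \<partial>P t x) - (\<integral>z. ?g z \<partial>P t y)\<bar> < e / 2) (time_at_top T)"
    if x: "x \<in> Y" and y: "y \<in> Y" for x y
  proof -
    obtain l where l: "real_of_int (site_norm l) \<le> L"
      and lim: "((\<lambda>t. \<P>(\<omega> in Q (x, y).
         restrict (fst (\<omega> t)) J = restrict (shift l (snd (\<omega> t))) J)) \<longlongrightarrow> 1) (time_at_top T)"
      (is "(?p \<longlongrightarrow> 1) _")
      using agree[OF x y \<open>finite J\<close>] by auto
    have "((\<lambda>t. 2 * C * (1 - ?p t)) \<longlongrightarrow> 2 * C * (1 - 1)) (time_at_top T)"
      by (intro tendsto_intros lim)
    then have ev: "eventually (\<lambda>t. 2 * C * (1 - ?p t) < e / 8) (time_at_top T)"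
      using \<open>0 < e\<close> by (intro order_tendstoD) auto
    have bnd: "\<bar>(\<integral>z. ?g z \<partial>P t x) - (\<integral>z. ?g z \<partial>P t y)\<bar> \<le> e / 8 + r n + 2 * C * (1 - ?p t)"
      if "t \<in> T" for t
      unfolding r_def
      by (intro coupling_expectation_bound[OF P Q that] \<open>finite J\<close> g_bound measurable_cube_average
          cube_average_shift[OF f(2)] cube_average_local[where I = I] I(2))
        (auto simp: m_def J_def intro: site_norm_le_imp_cube[OF l])
    show ?thesis
      using ev unfolding eventually_time_at_top
    proof (eventually_elim, intro impI)
      fix t assume "t \<in> T \<longrightarrow> 2 * C * (1 - ?p t) < e / 8" "t \<in> T"
      then show "\<bar>(\<integral>z. ?g z \<partial>P t x) - (\<integral>z. ?g z \<partial>P t y)\<bar> < e / 2"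
        using bnd[of t] n \<open>0 < e\<close> by linarith
    qed
  qed
  show ?thesis
  proof (intro exI[of _ n] ballI)
    fix \<nu> y assume \<nu>: "\<nu> \<in> translation_invariant_measures_on Y" and y: "y \<in> Y"
    then have sets [simp, measurable_cong]: "sets \<nu> = sets borel" and prob: "prob_space \<nu>"
      and inv: "translation_invariant \<nu>" and supp: "AE x in \<nu>. x \<in> Y"
      by (auto simp: translation_invariant_measures_on_def)
    interpret prob_space \<nu> by fact
    let ?h = "\<lambda>t x. (\<integral>z. ?g z \<partial>P t x) - (\<integral>z. ?g z \<partial>P t y)"
    have abs_int: "\<bar>\<integral>z. ?g z \<partial>P t x\<bar> \<le> C" if "t \<in> T" for t x
    proof -
      interpret Pt: prob_space "P t x" using P that by (rule prob_space_transition)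
      have "\<bar>\<integral>z. ?g z \<partial>P t x\<bar> \<le> (\<integral>z. \<bar>?g z\<bar> \<partial>P t x)" by (rule integral_abs_bound)
      also have "\<dots> \<le> C"
        using g_bound \<open>0 \<le> C\<close> by (intro Pt.integral_le_const Pt.integrable_const_bound[where B = C])
          (auto simp: measurable_cong_sets[OF sets_transition[OF P that] refl])
      finally show ?thesis .
    qed
    have meas: "(\<lambda>x. \<integral>z. ?g z \<partial>P t x) \<in> borel_measurable \<nu>" if "t \<in> T" for t
    proof -
      have "P t \<in> borel \<rightarrow>\<^sub>M subprob_algebra borel"
        using measurable_transition[OF P that] by (rule measurable_prob_algebraD)
      then have "(\<lambda>x. \<integral>z. ?g z \<partial>P t x) \<in> borel_measurable borel"
        by (rule measurable_compose) (rule integral_measurable_subprob_algebra, measurable)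
      then show ?thesis by (simp cong: measurable_cong_sets)
    qed
    have "eventually (\<lambda>t. \<bar>\<integral>x. ?h t x \<partial>\<nu>\<bar> < e) (time_at_top T)"
    proof (rule eventually_abs_integral_less[where C = "2 * C" and e = "e / 2"])
      show "AE x in \<nu>. eventually (\<lambda>t. \<bar>?h t x\<bar> < e / 2) (time_at_top T)"
        using supp by eventually_elim (rule pointwise[OF _ y])
      show "\<bar>?h t x\<bar> \<le> 2 * C" if "t \<in> T" for t x
        using abs_int[OF that, of x] abs_int[OF that, of y] by linarith
    qed (use meas \<open>0 < e\<close> in auto)
    moreover have "(\<integral>x. ?h t x \<partial>\<nu>) = (\<integral>x. f x \<partial>push P t \<nu>) - (\<integral>z. ?g z \<partial>P t y)" if t: "t \<in> T" for t
    proof -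
      have "integrable \<nu> (\<lambda>x. \<integral>z. ?g z \<partial>P t x)"
        using abs_int[OF t] meas[OF t] by (intro integrable_const_bound[where B = C]) auto
      then have "(\<integral>x. ?h t x \<partial>\<nu>) = (\<integral>x. (\<integral>z. ?g z \<partial>P t x) \<partial>\<nu>) - (\<integral>z. ?g z \<partial>P t y)"
        by (simp add: prob_space)
      also have "(\<integral>x. (\<integral>z. ?g z \<partial>P t x) \<partial>\<nu>) = (\<integral>x. ?g x \<partial>push P t \<nu>)"
        using integral_push[OF P t sets prob _ g_bound] by simp
      also have "\<dots> = (\<integral>x. f x \<partial>push P t \<nu>)"
        using sets_push[OF P t sets prob] prob_space_push[OF P t sets prob]
          translation_invariant_push[OF P t sets prob inv]
        by (intro integral_cube_average[where C = C] f(2)) auto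
      finally show ?thesis .
    qed
    ultimately show "eventually (\<lambda>t. \<bar>(\<integral>x. f x \<partial>push P t \<nu>) - (\<integral>z. ?g z \<partial>P t y)\<bar> < e) (time_at_top T)"
      unfolding eventually_time_at_top by (auto elim!: eventually_mono)
  qed
qed

theorem theorem5p2:
  fixes T :: "real set"
    and P :: "real \<Rightarrow> ('d::finite, 'a::alphabet) config \<Rightarrow> ('d, 'a) config measure"
    and X\<^sub>r :: "('d, 'a) config set"
    and \<mu> :: "('d, 'a) config measure"
    and L :: real
    and Q :: "('d, 'a) config \<times> ('d, 'a) config \<Rightarrow>
              (real \<Rightarrow> ('d, 'a) config \<times> ('d, 'a) config) measure"
  assumes "time_set T"
    and "particle_system T P"
    and "dynamically_invariant T P X\<^sub>r"
    and "\<mu> \<in> translation_invariant_measures_on X\<^sub>r"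
    and "invariant_measure T P \<mu>"
    and "coupling T P Q"
    and "\<And>x y I. x \<in> X\<^sub>r \<Longrightarrow> y \<in> X\<^sub>r \<Longrightarrow> finite I \<Longrightarrow>
           \<exists>l. real_of_int (site_norm l) \<le> L \<and>
             ((\<lambda>t. \<P>(\<omega> in Q (x, y).
                 restrict (fst (\<omega> t)) I = restrict (shift l (snd (\<omega> t))) I)) \<longlongrightarrow> 1)
               (time_at_top T)"
  shows "\<forall>\<nu> \<in> translation_invariant_measures_on X\<^sub>r.
           weakly_converges (\<lambda>t. push P t \<nu>) \<mu> (time_at_top T)"
  unfolding weakly_converges_def
proof (intro ballI allI impI tendstoI)
  fix \<nu> and f :: "('d, 'a) config \<Rightarrow> real" and e :: real
  assume \<nu>: "\<nu> \<in> translation_invariant_measures_on X\<^sub>r"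
    and f: "continuous_on UNIV f \<and> bounded (range f)" and "0 < e"
  obtain C where C: "\<And>x. \<bar>f x\<bar> \<le> C" using f by (auto simp: bounded_iff)
  interpret \<mu>: prob_space \<mu> using assms(4) by (simp add: translation_invariant_measures_on_def)
  have "AE x in \<mu>. x \<in> X\<^sub>r" using assms(4) by (simp add: translation_invariant_measures_on_def)
  then obtain y where y: "y \<in> X\<^sub>r" using \<mu>.AE_False by (metis (mono_tags, lifting) eventually_mono)
  have "0 < e / 2" using \<open>0 < e\<close> by simp
  then obtain n where n: "\<forall>\<nu>\<in>translation_invariant_measures_on X\<^sub>r. \<forall>y\<in>X\<^sub>r.
      eventually (\<lambda>t. \<bar>(\<integral>x. f x \<partial>push P t \<nu>) - (\<integral>z. cube_average n f z \<partial>P t y)\<bar> < e / 2)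
        (time_at_top T)"
    using push_eventually_close_to_point[OF assms(2,6,7) conjunct1[OF f] C] by meson
  have fixed: "push P t \<mu> = \<mu>" if "t \<in> T" for t
    using assms(5) that by (simp add: invariant_measure_def)
  from n \<nu> y have "eventually (\<lambda>t. \<bar>(\<integral>x. f x \<partial>push P t \<nu>)
      - (\<integral>z. cube_average n f z \<partial>P t y)\<bar> < e / 2) (time_at_top T)" by blast
  moreover from n assms(4) y have "eventually (\<lambda>t. \<bar>(\<integral>x. f x \<partial>push P t \<mu>)
      - (\<integral>z. cube_average n f z \<partial>P t y)\<bar> < e / 2) (time_at_top T)" by blast
  ultimately show "eventually (\<lambda>t. dist (\<integral>x. f x \<partial>push P t \<nu>) (\<integral>x. f x \<partial>\<mu>) < e)
      (time_at_top T)"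
    unfolding eventually_time_at_top
  proof (eventually_elim, intro impI)
    fix t assume near: "t \<in> T \<longrightarrow> \<bar>(\<integral>x. f x \<partial>push P t \<nu>) - (\<integral>z. cube_average n f z \<partial>P t y)\<bar> < e / 2"
      "t \<in> T \<longrightarrow> \<bar>(\<integral>x. f x \<partial>push P t \<mu>) - (\<integral>z. cube_average n f z \<partial>P t y)\<bar> < e / 2"
      and t: "t \<in> T"
    show "dist (\<integral>x. f x \<partial>push P t \<nu>) (\<integral>x. f x \<partial>\<mu>) < e"
      using near[rule_format, OF t] unfolding fixed[OF t] dist_real_def by linarith
  qed
qed

end
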